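(* Let $n$ be a natural number, and let $L_n := \{d : d \mid n,\ \sqrt{n} \le d < n\}$ be the set of positive divisors of $n$ that are at least $\sqrt{n}$ and strictly smaller than $n$. If the numbers in $L_n$ are in arithmetic progression, then one of the following is true: (i) $n = 1$, hence $L_n = \emptyset$. (ii) $n = p$ for some prime $p$, hence $L_n = \emptyset$. (iii) $n = p^2$ for some prime $p$, hence $L_n = \{p\}$. (iv) $n = p^3$ for some prime $p$, hence $L_n = \{p^2\}$. (v) $n = pq$ for some primes $p<q$, hence $L_n = \{q\}$. (vi) $n = p^4$ for some prime $p$, hence $L_n = \{p^2, p^3\}$. (vii) $n = p^5$ for some prime $p$, hence $L_n = \{p^3, p^4\}$. (viii) $n = p^2q$ for some primes $p<q$, hence $L_n = \{p^2, pq\}$ or $L_n = \{q, pq\}$. (ix) $n = pq^2$ for some primes $p<q$, hence $L_n = \{pq, q^2\}$. (x) $n = pqr$ for some primes $p<q<r$ with $pq<r$ and $p=\frac{1}{2}(q+1)$, hence $L_n = \{r, rp, rq\}$. (xi) $n = p^3q$ for some primes $p>q$ with $q = \frac{1}{2}(p+1)$, hence $L_n = \{p^2, p^2q, p^3\}$.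
   Context: Natural numbers are positive integers. The numbers in a finite set $S$ of natural numbers are said to be in arithmetic progression (or $S$ forms an arithmetic progression) if $S = \{d, d+a, d+2a, \ldots, d+(k-1)a\}$ for some natural numbers $d, a, k$; the empty set is regarded as vacuously forming an arithmetic progression. (In particular, every set with one or two elements forms an arithmetic progression.) *)

theory Defs
  imports Complex_Main "HOL-Computational_Algebra.Primes"
begin

definition large_divisors :: "nat \<Rightarrow> nat set" where
  "large_divisors n = {d. 0 < d \<and> d dvd n \<and> sqrt (real n) \<le> real d \<and> d < n}"

(* Natural numbers are positive here, hence the side conditions on d, a and k;
   k > 0 makes the progression nonempty, so the empty set is admitted separately. *)
definition arith_progression :: "nat set \<Rightarrow> bool" where
  "arith_progression S \<longleftrightarrow>
     S = {} \<or> (\<exists>d a k. 0 < d \<and> 0 < a \<and> 0 < k \<and> S = {d + i * a | i. i < k})"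

end

theory Submission
  imports Defs
begin

text \<open>
  The complementary divisor map \<open>d \<mapsto> n div d\<close> turns the large divisors of \<open>n\<close> into its small
  ones, the divisors \<open>d > 1\<close> with \<open>d\<^sup>2 \<le> n\<close>, and reverses their order. So the large divisors are in
  arithmetic progression exactly when the reciprocals of the small ones are, and then the small
  divisors \<open>f 0 < f 1 < \<dots>\<close> satisfy \<open>1/f i + 1/f (i+2) = 2/f (i+1)\<close>.

  This is very restrictive, because the first small divisors have a known shape: \<open>f 0\<close> is a prime
  \<open>p\<close>, and \<open>f 1\<close> is \<open>p\<^sup>2\<close> or another prime \<open>q\<close>. If there is a third one, then \<open>f 1 = p\<^sup>2\<close> would give
  \<open>1/f 2 = (2 - p)/p\<^sup>2 \<le> 0\<close>; and \<open>f 1 = q\<close> gives \<open>f 2 * (2 * p - q) = p * q\<close>, where \<open>2 * p - q\<close> is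
  coprime to \<open>p * q\<close> and so equals 1: \<open>f 2 = p * q\<close> and \<open>q = 2 * p - 1\<close>
  (lemma \<open>harmonic_primes\<close>). A fourth one would satisfy \<open>1/f 3 = (2 - p)/(p * q) \<le> 0\<close>. Hence
  the set of small divisors is empty, \<open>{p}\<close>, \<open>{p, p\<^sup>2}\<close>, \<open>{p, q}\<close> or \<open>{p, q, p * q}\<close>
  (lemma \<open>small_divisors_shape\<close>).

  The small divisors determine all divisors, which leaves few possibilities for \<open>n\<close>. If the cofactor
  of the largest small divisor is composite, it is divisible by a small prime (lemma
  \<open>composite_divisor_has_small_prime\<close>), and this produces a divisor of \<open>n\<close> that is not in the list
  of small ones, such as \<open>p\<^sup>2\<close> when only \<open>p\<close> is small; for \<open>{p, q}\<close> there is always \<open>p * q\<close>. Such a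
  divisor must be complementary to 1 or to a small divisor (lemma \<open>divisor_cases\<close>), and this yields \<open>n\<close>.
\<close>

section \<open>Small divisors\<close>

definition small_divisors :: "nat \<Rightarrow> nat set" where
  "small_divisors n = {d. d dvd n \<and> 1 < d \<and> d * d \<le> n}"

lemma sqrt_le_iff_le_square: "sqrt (real n) \<le> real d \<longleftrightarrow> n \<le> d * d"
proof -
  have "sqrt (real n) \<le> sqrt ((real d)\<^sup>2) \<longleftrightarrow> real n \<le> (real d)\<^sup>2"
    by (rule real_sqrt_le_iff)
  also have "(real d)\<^sup>2 = real (d * d)" by (simp add: power2_eq_square)
  finally show ?thesis unfolding of_nat_le_iff by simp
qed

lemma complementary_large_iff_small:
  fixes n d e :: nat
  assumes "n > 0" "n = d * e"
  shows "e \<in> large_divisors n \<longleftrightarrow> d \<in> small_divisors n"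
proof -
  have "d > 0" "e > 0" using assms by auto
  then have "n \<le> e * e \<longleftrightarrow> d * d \<le> n"
    using assms by (metis mult.commute mult_le_cancel2 nat_mult_le_cancel1)
  moreover have "e < n \<longleftrightarrow> 1 < d" using assms \<open>e > 0\<close> by simp
  moreover have "d dvd n" "e dvd n" using assms by simp_all
  ultimately show ?thesis using \<open>e > 0\<close>
    unfolding large_divisors_def small_divisors_def sqrt_le_iff_le_square by auto
qed

lemma large_divisors_eq_image:
  assumes "n > 0"
  shows "large_divisors n = (\<lambda>d. n div d) ` small_divisors n"
proof (intro equalityI subsetI)
  fix e assume e: "e \<in> large_divisors n"
  then have "n = n div e * e" "e > 0" by (auto simp: large_divisors_def)
  moreover from this have "n div (n div e) = e"
    using assms by (metis div_by_0 nonzero_mult_div_cancel_left mult_zero_left less_numeral_extra(3))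
  ultimately show "e \<in> (\<lambda>d. n div d) ` small_divisors n"
    using complementary_large_iff_small[OF assms] e by (metis image_eqI)
next
  fix e assume "e \<in> (\<lambda>d. n div d) ` small_divisors n"
  then obtain d where d: "d \<in> small_divisors n" "e = n div d" by auto
  then have "n = d * e" by (simp add: small_divisors_def)
  then show "e \<in> large_divisors n"
    using complementary_large_iff_small[OF assms] d by metis
qed

lemma small_divisors_eq_image:
  assumes "n > 0"
  shows "small_divisors n = (\<lambda>d. n div d) ` large_divisors n"
proof -
  have "n div (n div d) = d" if "d \<in> small_divisors n" for d
    using that assms by (auto simp: small_divisors_def elim!: dvdE)
  then show ?thesis
    by (simp add: large_divisors_eq_image[OF assms] image_image)
qed

lemma divisor_cases:
  fixes n d :: nat
  assumes "n > 0" "d dvd n"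
  obtains "d = 1" | "d \<in> small_divisors n" | "d = n" | e where "e \<in> small_divisors n" "n = d * e"
proof -
  obtain e where e: "n = d * e" using assms by blast
  show ?thesis
  proof (cases "d * d \<le> n")
    case True
    then show ?thesis using assms that(1,2) by (cases "d = 1") (auto simp: small_divisors_def)
  next
    case False
    then have "e < d" using e by simp
    then have "e * e \<le> n" using e by simp
    then show ?thesis using assms e that(3,4) by (cases "e = 1") (auto simp: small_divisors_def)
  qed
qed

lemma small_divisors_mono_dvd:
  fixes n d e :: nat
  assumes "d \<in> small_divisors n" "e dvd d" "1 < e"
  shows "e \<in> small_divisors n"
proof -
  have "e \<le> d" using assms by (auto simp: small_divisors_def intro!: dvd_imp_le)
  then have "e * e \<le> d * d" by (rule mult_le_mono)(fact)
  then show ?thesis using assms by (auto simp: small_divisors_def)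
qed

text \<open>The least prime factor \<open>t\<close> of a composite \<open>m\<close> satisfies \<open>t\<^sup>2 \<le> m \<le> n\<close>, as in trial division.\<close>

lemma composite_divisor_has_small_prime:
  fixes n m :: nat
  assumes "n > 0" "m dvd n" "1 < m" "\<not> prime m"
  obtains t where "prime t" "t dvd m" "t \<in> small_divisors n"
proof -
  obtain t where t: "prime t" "t dvd m" "t\<^sup>2 \<le> m"
  proof -
    obtain a b where ab: "m = a * b" "1 < a" "1 < b" "a \<le> b"
    proof -
      obtain a where a: "a dvd m" "a \<noteq> 1" "a \<noteq> m"
        using assms by (auto simp: prime_nat_iff)
      then obtain b where b: "m = a * b" by blast
      have "a \<noteq> 0" "b \<noteq> 0" "b \<noteq> 1" using a b assms by auto
      then have "1 < a" "1 < b" using a by simp_all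
      then show ?thesis using that[of a b] that[of b a] b by (cases "a \<le> b") (auto simp: mult.commute)
    qed
    obtain t where "prime t" "t dvd a" using ab prime_factor_nat[of a] by auto
    moreover from this have "t \<le> a" using ab by (auto intro!: dvd_imp_le)
    then have "t * t \<le> a * b" using ab by (intro mult_le_mono) auto
    ultimately show ?thesis using that ab by (auto simp: power2_eq_square)
  qed
  have "m \<le> n" using assms by (simp add: dvd_imp_le)
  with t assms have "t \<in> small_divisors n"
    by (auto simp: small_divisors_def power2_eq_square prime_gt_Suc_0_nat intro: dvd_trans)
  then show ?thesis using t that by blast
qed

section \<open>Harmonic triples\<close>

text \<open>The equation \<open>1/x + 1/z = 2/y\<close> with the denominators cleared.\<close>

definition harmonic :: "nat \<Rightarrow> nat \<Rightarrow> nat \<Rightarrow> bool" where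
  "harmonic x y z \<longleftrightarrow> x * y + y * z = 2 * x * z"

lemma harmonic_of_arithmetic_cofactors:
  fixes n u v w x y z :: nat
  assumes "n > 0" "n = x * u" "n = y * v" "n = z * w" "u + w = 2 * v"
  shows "harmonic x y z"
proof -
  have "n * (x * y + y * z) = (x * y * z) * (u + w)"
    using assms(2,4) by (metis (no_types, lifting) add_mult_distrib2 mult.assoc mult.commute add.commute)
  also have "\<dots> = n * (2 * x * z)"
    using assms(3,5) by (simp add: ac_simps)
  finally show ?thesis using \<open>n > 0\<close> by (simp add: harmonic_def)
qed

lemma arith_progression_descending:
  assumes "arith_progression S"
  obtains M a k where "0 < a" "k = 0 \<or> (k - 1) * a < M" "S = (\<lambda>i. M - i * a) ` {..<k}"
proof (cases "S = {}")
  case True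
  then show ?thesis using that[of 1 0 0] by simp
next
  case False
  then obtain d a k where dak: "0 < d" "0 < a" "0 < (k::nat)" "S = {d + i * a | i. i < k}"
    using assms by (auto simp: arith_progression_def)
  define M where "M = d + (k - 1) * a"
  have shift: "M - i * a = d + (k - 1 - i) * a" if "i < k" for i
  proof -
    obtain j where "k = Suc (i + j)" using \<open>i < k\<close> less_iff_Suc_add by auto
    then show ?thesis by (simp add: M_def add_mult_distrib)
  qed
  have "S = (\<lambda>i. d + i * a) ` {..<k}" using dak by auto
  also have "\<dots> = (\<lambda>i. d + i * a) ` (\<lambda>i. k - 1 - i) ` {..<k}"
  proof -
    have "(\<lambda>i. k - 1 - i) ` {..<k} = {..<k}"
    proof (intro equalityI subsetI)
      fix i assume "i \<in> {..<k}"
      then show "i \<in> (\<lambda>i. k - 1 - i) ` {..<k}"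
        by (intro image_eqI[of _ _ "k - 1 - i"]) auto
    qed auto
    then show ?thesis by simp
  qed
  also have "\<dots> = (\<lambda>i. M - i * a) ` {..<k}"
    unfolding image_image by (rule image_cong) (auto simp: shift)
  finally show ?thesis using that[of a k M] dak by (simp add: M_def)
qed

text \<open>
  Dividing \<open>n\<close> by the terms of a progression reverses it, so the descending enumeration of the
  large divisors becomes an ascending one of the small divisors.
\<close>

lemma small_divisors_harmonic_enumeration:
  assumes "n > 0" "arith_progression (large_divisors n)"
  obtains f and k :: nat where "small_divisors n = f ` {..<k}" "strict_mono_on {..<k} f"
    "\<forall>i. i + 2 < k \<longrightarrow> harmonic (f i) (f (i + 1)) (f (i + 2))"
proof -
  obtain M a k where Mak: "0 < a" "k = 0 \<or> (k - 1) * a < M"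
    "large_divisors n = (\<lambda>i. M - i * a) ` {..<k}"
    by (rule arith_progression_descending[OF assms(2)])
  define f where "f = (\<lambda>i. n div (M - i * a))"
  have less: "i * a < M" if "i < k" for i
  proof -
    have "i * a \<le> (k - 1) * a" using that by (intro mult_le_mono) auto
    moreover have "(k - 1) * a < M" using that Mak(2) by auto
    ultimately show ?thesis by linarith
  qed
  have prod: "n = f i * (M - i * a)" if "i < k" for i
  proof -
    have "M - i * a \<in> large_divisors n" using that Mak(3) by auto
    then show ?thesis by (simp add: f_def large_divisors_def)
  qed
  have "small_divisors n = f ` {..<k}"
    by (simp add: small_divisors_eq_image[OF assms(1)] Mak(3) image_image f_def)
  moreover have "strict_mono_on {..<k} f"
  proof (rule strict_mono_onI)
    fix i j assume ij: "i \<in> {..<k}" "j \<in> {..<k}" "i < j"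
    have "i * a < j * a" using ij Mak(1) by simp
    then have lt: "M - j * a < M - i * a" using less[of i] ij by (intro diff_less_mono2) auto
    show "f i < f j"
    proof (rule ccontr)
      assume "\<not> f i < f j"
      then have "f j \<le> f i" by simp
      moreover have "0 < f i" using prod[of i] ij \<open>n > 0\<close> by (metis gr0I lessThan_iff mult_0 less_irrefl)
      ultimately have "f j * (M - j * a) < f i * (M - i * a)"
        using lt by (meson le_less_trans mult_le_mono1 mult_less_mono2)
      then show False using prod[of i] prod[of j] ij by auto
    qed
  qed
  moreover have "harmonic (f i) (f (i + 1)) (f (i + 2))" if "i + 2 < k" for i
  proof (rule harmonic_of_arithmetic_cofactors[OF \<open>n > 0\<close> prod prod prod])
    show "M - i * a + (M - (i + 2) * a) = 2 * (M - (i + 1) * a)"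
    proof -
      have "(i + 2) * a = i * a + 2 * a" "(i + 1) * a = i * a + a"
        by (simp_all add: add_mult_distrib)
      then show ?thesis using less[OF that] by linarith
    qed
  qed (use that in auto)
  ultimately show ?thesis using that by blast
qed

text \<open>The equation reduces to \<open>p\<^sup>2 = (2 - p) * r\<close>, whose right-hand side is not positive.\<close>

lemma harmonic_square:
  assumes "1 < p"
  shows "\<not> harmonic p (p\<^sup>2) r"
proof
  assume "harmonic p (p\<^sup>2) r"
  then have "p * (p\<^sup>2 + p * r) = p * (2 * r)"
    by (simp add: harmonic_def algebra_simps power2_eq_square)
  then have "p\<^sup>2 + p * r = 2 * r" "0 < p\<^sup>2" using assms by simp_all
  moreover have "2 * r \<le> p * r" using assms by (intro mult_le_mono) auto
  ultimately show False by linarith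
qed

text \<open>
  Modulo \<open>p\<close> and modulo \<open>q\<close> the equation \<open>p * q + q * r = 2 * p * r\<close> shows that \<open>p * q\<close> divides \<open>r\<close>;
  conversely \<open>r\<close> divides \<open>p * q = r * (2 * p - q)\<close>.
\<close>

lemma harmonic_primes:
  assumes "prime p" "prime q" "p < q" "harmonic p q r"
  shows "r = p * q" "q + 1 = 2 * p"
proof -
  have eq: "p * q + q * r = 2 * p * r" using assms by (simp add: harmonic_def)
  have "2 \<le> p" using assms by (simp add: prime_ge_2_nat)
  have "p dvd q * r"
    using eq by (metis dvd_add_right_iff dvd_triv_left dvd_mult2 dvd_triv_right mult.assoc)
  moreover have "\<not> p dvd q" using assms primes_dvd_imp_eq by blast
  ultimately have "p dvd r" using assms by (simp add: prime_dvd_mult_iff)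
  have "q dvd 2 * p * r" by (simp flip: eq)
  moreover have "\<not> q dvd 2" "\<not> q dvd p"
    using assms(3) \<open>2 \<le> p\<close> by (simp_all add: nat_dvd_not_less)
  ultimately have "q dvd r" using assms by (simp add: prime_dvd_mult_iff)
  with \<open>p dvd r\<close> have "p * q dvd r"
    using assms by (intro divides_mult) (auto intro: primes_coprime)
  then obtain c where c: "r = p * q * c" by blast
  have "(p * q) * (1 + q * c) = (p * q) * (2 * p * c)"
    using eq unfolding c by (simp add: algebra_simps)
  moreover have "p * q \<noteq> 0" using \<open>2 \<le> p\<close> \<open>p < q\<close> by simp
  ultimately have e: "1 + q * c = 2 * p * c" using mult_left_cancel by blast
  have "c dvd 1"
    using e by (metis dvd_add_left_iff dvd_triv_right)
  then have "c = 1" by simp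
  with c e show "r = p * q" "q + 1 = 2 * p" by auto
qed

text \<open>
  This excludes a fourth small divisor: the middle term is the third one, as given by
  \<open>harmonic_primes\<close>, and again the equation reduces to \<open>p * q = (2 - p) * s\<close>.
\<close>

lemma harmonic_product:
  assumes "1 < p" "0 < q"
  shows "\<not> harmonic q (p * q) s"
proof
  assume "harmonic q (p * q) s"
  then have "q * (p * q + p * s) = q * (2 * s)" by (simp add: harmonic_def algebra_simps)
  then have "p * q + p * s = 2 * s" using assms by simp
  moreover have "2 * s \<le> p * s" using assms by (intro mult_le_mono) auto
  moreover have "0 < p * q" using assms by simp
  ultimately show False by linarith
qed

section \<open>The possible sets of small divisors\<close>

text \<open>
  The set of small divisors is closed under taking divisors greater than 1, so such a
  proper divisor of one of its first two elements comes even earlier in the enumeration.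
\<close>

lemma least_small_divisor_prime:
  assumes "p \<in> small_divisors n" "\<And>x. x \<in> small_divisors n \<Longrightarrow> p \<le> x"
  shows "prime p"
proof -
  have "1 < p" using assms by (simp add: small_divisors_def)
  then obtain t where t: "prime t" "t dvd p" using prime_factor_nat[of p] by auto
  then have "t \<in> small_divisors n"
    using small_divisors_mono_dvd[OF assms(1)] by (simp add: prime_gt_Suc_0_nat)
  then have "p \<le> t" using assms by blast
  moreover have "t \<le> p" using t \<open>1 < p\<close> by (auto intro!: dvd_imp_le)
  ultimately show ?thesis using t by simp
qed

lemma second_small_divisor_prime_or_square:
  assumes "q \<in> small_divisors n" "\<And>x. x \<in> small_divisors n \<Longrightarrow> x = p \<or> q \<le> x"
  shows "prime q \<or> q = p\<^sup>2"
proof (cases "prime q")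
  case False
  have "1 < q" using assms by (simp add: small_divisors_def)
  have proper: "x = p" if "x dvd q" "x \<noteq> 1" "x \<noteq> q" for x
  proof -
    have "x \<le> q" "x \<noteq> 0" using that \<open>1 < q\<close> by (auto intro: dvd_imp_le)
    then have "x \<in> small_divisors n"
      using small_divisors_mono_dvd[OF assms(1)] that by simp
    then show ?thesis using assms(2)[of x] that \<open>x \<le> q\<close> by auto
  qed
  obtain x where x: "x dvd q" "x \<noteq> 1" "x \<noteq> q"
    using False \<open>1 < q\<close> by (auto simp: prime_nat_iff)
  then obtain y where y: "q = x * y" by blast
  have "y \<noteq> 0" using y \<open>1 < q\<close> by (intro notI) simp
  then have "y \<noteq> 1" "y \<noteq> q" using x y by auto
  then have "x = p" "y = p" using proper x y by auto
  then show ?thesis using y by (simp add: power2_eq_square)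
qed simp

lemma small_divisors_shape:
  assumes "n > 0" "arith_progression (large_divisors n)"
  obtains
    (empty) "small_divisors n = {}"
  | (one) p where "prime p" "small_divisors n = {p}"
  | (square) p where "prime p" "small_divisors n = {p, p\<^sup>2}"
  | (two) p q where "prime p" "prime q" "p < q" "small_divisors n = {p, q}"
  | (three) p q where "prime p" "prime q" "p < q" "q + 1 = 2 * p" "small_divisors n = {p, q, p * q}"
proof -
  obtain f and k :: nat where S: "small_divisors n = f ` {..<k}"
    and mono: "strict_mono_on {..<k} f"
    and harm: "\<forall>i. i + 2 < k \<longrightarrow> harmonic (f i) (f (i + 1)) (f (i + 2))"
    by (rule small_divisors_harmonic_enumeration[OF assms])
  have le: "f i \<le> f j" if "i \<le> j" "j < k" for i j
    using mono that by (auto simp: strict_mono_on_def le_less)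
  have prime0: "prime (f 0)" if "0 < k"
    by (rule least_small_divisor_prime[of _ n]) (use S le that in auto)
  have prime1: "prime (f 1) \<or> f 1 = (f 0)\<^sup>2" if "1 < k"
  proof (rule second_small_divisor_prime_or_square[of _ n])
    fix x assume "x \<in> small_divisors n"
    then obtain i where "i < k" "x = f i" using S by auto
    then show "x = f 0 \<or> f 1 \<le> x" using le[of 1 i] by (cases i) auto
  qed (use S that in auto)
  have less01: "f 0 < f 1" if "1 < k" using mono that by (auto simp: strict_mono_on_def)
  consider "k = 0" | "k = 1" | "k = 2" | "3 \<le> k" by linarith
  then show ?thesis
  proof cases
    assume "k = 0"
    then show ?thesis using S empty by simp
  next
    assume "k = 1"
    then show ?thesis using S one prime0 by (simp add: lessThan_Suc)
  next
    assume "k = 2"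
    then have "small_divisors n = {f 0, f 1}" using S by (auto simp: numeral_2_eq_2 lessThan_Suc)
    then show ?thesis using prime0 prime1 less01 square[of "f 0"] two[of "f 0" "f 1"] \<open>k = 2\<close> by auto
  next
    assume "3 \<le> k"
    have p: "prime (f 0)" using prime0 \<open>3 \<le> k\<close> by simp
    then have "1 < f 0" by (simp add: prime_gt_Suc_0_nat)
    have lt: "f 0 < f 1" using less01 \<open>3 \<le> k\<close> by simp
    have h: "harmonic (f 0) (f 1) (f 2)" using harm[rule_format, of 0] \<open>3 \<le> k\<close> by (simp add: numeral_2_eq_2)
    then have "f 1 \<noteq> (f 0)\<^sup>2" using harmonic_square[OF \<open>1 < f 0\<close>] by metis
    then have q: "prime (f 1)" using prime1 \<open>3 \<le> k\<close> by auto
    note pq = harmonic_primes[OF p q lt h]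
    have "k = 3"
    proof (rule ccontr)
      assume "k \<noteq> 3"
      then have "harmonic (f 1) (f 0 * f 1) (f 3)"
        using harm[rule_format, of 1] \<open>3 \<le> k\<close> pq(1) by (simp add: numeral_2_eq_2 numeral_3_eq_3)
      then show False using harmonic_product[OF \<open>1 < f 0\<close>] lt by auto
    qed
    then have "small_divisors n = {f 0, f 1, f 2}"
      using S by (auto simp: numeral_2_eq_2 numeral_3_eq_3 lessThan_Suc)
    then show ?thesis using three[OF p q lt pq(2)] pq(1) by simp
  qed
qed

section \<open>Recovering the number from its small divisors\<close>

lemma no_small_divisors:
  assumes "n > 0" "small_divisors n = {}"
  shows "n = 1 \<or> prime n"
proof (rule ccontr)
  assume "\<not> (n = 1 \<or> prime n)"
  then have "1 < n" "\<not> prime n" using assms(1) by simp_all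
  then show False
    using composite_divisor_has_small_prime[OF assms(1) dvd_refl] assms(2) by blast
qed

lemma one_small_divisor:
  assumes "n > 0" "prime p" "small_divisors n = {p}"
  shows "n = p ^ 2 \<or> n = p ^ 3 \<or> (\<exists>q. prime q \<and> p < q \<and> n = p * q)"
proof -
  have p: "p dvd n" "1 < p" "p * p \<le> n" using assms(3) by (auto simp: small_divisors_def)
  then obtain m where m: "n = p * m" by blast
  have "p \<le> m" using p m by simp
  show ?thesis
  proof (cases "prime m")
    case True
    then show ?thesis using m \<open>p \<le> m\<close> by (cases "p = m") (auto simp: power2_eq_square)
  next
    case False
    then obtain t where "t dvd m" "t \<in> small_divisors n"
      using composite_divisor_has_small_prime[of n m] m p \<open>p \<le> m\<close> assms(1) by auto
    then have "p dvd m" using assms(3) by simp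
    then have "p\<^sup>2 dvd n" using m by (simp add: power2_eq_square)
    from assms(1) this show ?thesis
    proof (cases rule: divisor_cases)
      case 1
      then show ?thesis using \<open>1 < p\<close> by simp
    next
      case 2
      then show ?thesis using assms(3) \<open>1 < p\<close> by (simp add: power2_eq_square)
    next
      case 3
      then show ?thesis by simp
    next
      case (4 e)
      then have "n = p ^ 3" using assms(3) by (simp add: power2_eq_square power3_eq_cube)
      then show ?thesis by simp
    qed
  qed
qed

lemma two_small_divisors_square:
  assumes "n > 0" "prime p" "small_divisors n = {p, p\<^sup>2}"
  shows "n = p ^ 4 \<or> n = p ^ 5 \<or> (\<exists>q. prime q \<and> p < q \<and> n = p\<^sup>2 * q)"
proof -
  have p: "p\<^sup>2 dvd n" "1 < p" "p\<^sup>2 * p\<^sup>2 \<le> n"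
  proof -
    have "p\<^sup>2 \<in> small_divisors n" "p \<in> small_divisors n" using assms(3) by simp_all
    then show "p\<^sup>2 dvd n" "1 < p" "p\<^sup>2 * p\<^sup>2 \<le> n" by (simp_all only: small_divisors_def mem_Collect_eq)
  qed
  then obtain m where m: "n = p\<^sup>2 * m" by blast
  have "p\<^sup>2 \<le> m" using p(2,3) unfolding m by (simp only: nat_mult_le_cancel1 zero_less_power)
  moreover have "p < p\<^sup>2" using p by (simp add: power2_eq_square)
  ultimately have "p < m" by simp
  show ?thesis
  proof (cases "prime m")
    case True
    then show ?thesis using m \<open>p < m\<close> by auto
  next
    case False
    moreover have "m dvd n" "1 < m" using m p \<open>p < m\<close> by simp_all
    ultimately obtain t where t: "prime t" "t dvd m" "t \<in> small_divisors n"
      using composite_divisor_has_small_prime[OF assms(1)] by blast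
    have "t = p" using t(1,3) assms(3) by (auto simp: prime_power_iff)
    then have "p ^ 3 dvd n" using m t(2) by (simp add: eval_nat_numeral mult_dvd_mono mult.assoc)
    from assms(1) this show ?thesis
    proof (cases rule: divisor_cases)
      case 1
      then show ?thesis using \<open>1 < p\<close> by simp
    next
      case 2
      then show ?thesis using assms(3) \<open>1 < p\<close> by (simp add: power2_eq_square power3_eq_cube)
    next
      case 3
      have "p ^ 3 < p ^ 4" using \<open>1 < p\<close> by (rule power_strict_increasing[rotated]) simp
      also have "p ^ 4 = p\<^sup>2 * p\<^sup>2" by (simp flip: power_add)
      finally show ?thesis using 3 p(3) by simp
    next
      case (4 e)
      then have "n = p ^ 4 \<or> n = p ^ 5"
        using assms(3) by (auto simp: eval_nat_numeral)
      then show ?thesis by blast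
    qed
  qed
qed

text \<open>Here \<open>p * q\<close> is the divisor which is not small; it is not \<open>n\<close> itself because \<open>q\<^sup>2 \<le> n\<close>.\<close>

lemma two_small_divisors_primes:
  assumes "n > 0" "prime p" "prime q" "p < q" "small_divisors n = {p, q}"
  shows "n = p\<^sup>2 * q \<or> n = p * q\<^sup>2"
proof -
  have p: "p dvd n" "1 < p" and q: "q dvd n" "q * q \<le> n"
    using assms(5) by (auto simp: small_divisors_def set_eq_iff)
  have "p * q dvd n"
    using assms p q by (intro divides_mult) (auto intro: primes_coprime)
  have "p * q < q * q" using assms p by simp
  then have "p * q \<noteq> n" using q by linarith
  have "1 < q" using p assms by simp
  from assms(1) \<open>p * q dvd n\<close> show ?thesis
  proof (cases rule: divisor_cases)
    case 1
    then show ?thesis using \<open>1 < p\<close> by simp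
  next
    case 2
    then show ?thesis using assms(5) \<open>1 < p\<close> \<open>1 < q\<close> by simp
  next
    case 3
    then show ?thesis using \<open>p * q \<noteq> n\<close> by contradiction
  next
    case (4 e)
    then show ?thesis using assms(5) by (auto simp: power2_eq_square)
  qed
qed

text \<open>
  The cofactor \<open>m\<close> of \<open>p * q\<close> is at least \<open>p * q\<close>. It is prime to \<open>p\<close>, since \<open>p\<^sup>2 < p * q\<close> would be
  small; so it is itself prime or divisible by \<open>q\<close>, and in the latter case \<open>q\<^sup>2\<close> is a divisor
  which is not small.
\<close>

lemma three_small_divisors:
  assumes "n > 0" "prime p" "prime q" "p < q" "small_divisors n = {p, q, p * q}"
  shows "n = p * q ^ 3 \<or> (\<exists>r. prime r \<and> p * q < r \<and> n = p * q * r)"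
proof -
  have pq: "p * q dvd n" "p * q * (p * q) \<le> n" "1 < p"
    using assms(5) by (auto simp: small_divisors_def set_eq_iff)
  have "1 < q" using pq assms by simp
  obtain m where m: "n = p * q * m" using pq by blast
  have "p * q \<le> m" using pq m \<open>1 < q\<close> by simp
  show ?thesis
  proof (cases "prime m")
    case True
    moreover have "\<not> prime (p * q)" using \<open>1 < p\<close> \<open>1 < q\<close> by (auto dest: prime_product)
    ultimately have "p * q \<noteq> m" by auto
    then show ?thesis using True m \<open>p * q \<le> m\<close> by auto
  next
    case False
    have "\<not> p dvd m"
    proof
      assume "p dvd m"
      then have "p * p dvd n" using m by (auto intro: mult_dvd_mono)
      moreover have "p * p \<le> p * q" using assms by simp
      then have "p * p * (p * p) \<le> p * q * (p * q)" by (rule mult_le_mono)(fact)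
      then have "p * p * (p * p) \<le> n" using pq(2) by linarith
      moreover have "1 < p * p" using \<open>1 < p\<close> \<open>1 < p\<close> by (rule less_1_mult)
      ultimately have "p * p \<in> small_divisors n" by (simp add: small_divisors_def)
      then have "p * p \<in> {p, q, p * q}" using assms(5) by simp
      moreover have "p * p \<noteq> q" using assms(3) \<open>1 < p\<close> by (auto dest: prime_product)
      ultimately show False using assms(4) \<open>1 < p\<close> by simp
    qed
    have "1 < p * q" using \<open>1 < p\<close> \<open>1 < q\<close> by (rule less_1_mult)
    then have "1 < m" using \<open>p * q \<le> m\<close> by linarith
    moreover have "m dvd n" using m by simp
    ultimately obtain t where t: "t dvd m" "t \<in> small_divisors n"
      using composite_divisor_has_small_prime[OF assms(1)] False by blast
    then have "t = q \<or> t = p * q" using assms(5) \<open>\<not> p dvd m\<close> by auto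
    then have "q dvd m" using t(1) dvd_mult_right by blast
    then have "p * q * q dvd n" unfolding m by (rule mult_dvd_mono[OF dvd_refl])
    then have "q\<^sup>2 dvd n" by (metis dvd_mult_right mult.assoc power2_eq_square)
    from assms(1) this show ?thesis
    proof (cases rule: divisor_cases)
      case 1
      then show ?thesis using \<open>1 < q\<close> by (simp add: power2_eq_square)
    next
      case 2
      then have "q * q \<in> {p, q, p * q}" using assms(5) by (simp add: power2_eq_square)
      moreover have "q * q \<noteq> p" using assms(2) \<open>1 < q\<close> by (auto dest: prime_product)
      ultimately show ?thesis using assms(4) \<open>1 < q\<close> by simp
    next
      case 3
      then have "q = p * m" using m \<open>1 < q\<close> by (simp add: power2_eq_square)
      then show ?thesis using assms(2-4) primes_dvd_imp_eq[of p q] by simp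
    next
      case (4 e)
      then have "q * e = p * m" using m \<open>1 < q\<close> by (simp add: power2_eq_square)
      moreover have "e \<noteq> p"
      proof
        assume "e = p"
        then have "q = m" using \<open>q * e = p * m\<close> \<open>1 < p\<close> by simp
        then show False using \<open>p * q \<le> m\<close> \<open>1 < p\<close> \<open>1 < q\<close> by simp
      qed
      moreover have "e \<noteq> q"
      proof
        assume "e = q"
        then have "p dvd q * q" using \<open>q * e = p * m\<close> by simp
        then have "p dvd q" using assms(2) by (simp add: prime_dvd_mult_iff)
        then show False using assms primes_dvd_imp_eq by blast
      qed
      ultimately have "n = q\<^sup>2 * (p * q)" using 4 assms(5) by auto
      then show ?thesis by (simp add: power2_eq_square power3_eq_cube)
    qed
  qed
qed

section \<open>The classification\<close>

theorem theorem1p1: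
  fixes n :: nat
  assumes "n > 0"
    and "arith_progression (large_divisors n)"
  shows
    "(n = 1 \<and> large_divisors n = {})
   \<or> (\<exists>p. prime p \<and> n = p \<and> large_divisors n = {})
   \<or> (\<exists>p. prime p \<and> n = p ^ 2 \<and> large_divisors n = {p})
   \<or> (\<exists>p. prime p \<and> n = p ^ 3 \<and> large_divisors n = {p ^ 2})
   \<or> (\<exists>p q. prime p \<and> prime q \<and> p < q \<and> n = p * q \<and> large_divisors n = {q})
   \<or> (\<exists>p. prime p \<and> n = p ^ 4 \<and> large_divisors n = {p ^ 2, p ^ 3})
   \<or> (\<exists>p. prime p \<and> n = p ^ 5 \<and> large_divisors n = {p ^ 3, p ^ 4})
   \<or> (\<exists>p q. prime p \<and> prime q \<and> p < q \<and> n = p ^ 2 * q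
        \<and> (large_divisors n = {p ^ 2, p * q} \<or> large_divisors n = {q, p * q}))
   \<or> (\<exists>p q. prime p \<and> prime q \<and> p < q \<and> n = p * q ^ 2
        \<and> large_divisors n = {p * q, q ^ 2})
   \<or> (\<exists>p q r. prime p \<and> prime q \<and> prime r \<and> p < q \<and> q < r \<and> n = p * q * r
        \<and> p * q < r \<and> real p = 1 / 2 * (real q + 1)
        \<and> large_divisors n = {r, r * p, r * q})
   \<or> (\<exists>p q. prime p \<and> prime q \<and> p > q \<and> n = p ^ 3 * q
        \<and> real q = 1 / 2 * (real p + 1)
        \<and> large_divisors n = {p ^ 2, p ^ 2 * q, p ^ 3})"
proof -
  have L: "large_divisors n = (\<lambda>d. n div d) ` small_divisors n"
    by (rule large_divisors_eq_image) fact
  from assms show ?thesis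
  proof (cases rule: small_divisors_shape)
    case empty
    then show ?thesis using no_small_divisors[OF \<open>n > 0\<close>] L by auto
  next
    case (one p)
    have "0 < p" using one by (simp add: prime_gt_0_nat)
    from one_small_divisor[OF \<open>n > 0\<close> one] show ?thesis
    proof (elim disjE exE conjE)
      assume "n = p ^ 2"
      moreover from this have "large_divisors n = {p}"
        using L one \<open>0 < p\<close> by (simp add: power2_eq_square)
      ultimately have "\<exists>p. prime p \<and> n = p ^ 2 \<and> large_divisors n = {p}"
        using one by blast
      then show ?thesis by (simp only: simp_thms)
    next
      assume "n = p ^ 3"
      moreover from this have "large_divisors n = {p ^ 2}"
        using L one \<open>0 < p\<close> by (simp add: power2_eq_square power3_eq_cube)
      ultimately have "\<exists>p. prime p \<and> n = p ^ 3 \<and> large_divisors n = {p ^ 2}"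
        using one by blast
      then show ?thesis by (simp only: simp_thms)
    next
      fix q assume q: "prime q" "p < q" "n = p * q"
      moreover from this have "large_divisors n = {q}"
        using L one \<open>0 < p\<close> by simp
      ultimately have "\<exists>p q. prime p \<and> prime q \<and> p < q \<and> n = p * q
          \<and> large_divisors n = {q}"
        using one by blast
      then show ?thesis by (simp only: simp_thms)
    qed
  next
    case (square p)
    have "0 < p" using square by (simp add: prime_gt_0_nat)
    from two_small_divisors_square[OF \<open>n > 0\<close> square] show ?thesis
    proof (elim disjE exE conjE)
      assume "n = p ^ 4"
      moreover from this have "large_divisors n = {p ^ 2, p ^ 3}"
        using L square \<open>0 < p\<close> by (auto simp: eval_nat_numeral)
      ultimately have "\<exists>p. prime p \<and> n = p ^ 4
          \<and> large_divisors n = {p ^ 2, p ^ 3}"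
        using square by blast
      then show ?thesis by (simp only: simp_thms)
    next
      assume "n = p ^ 5"
      moreover from this have "large_divisors n = {p ^ 3, p ^ 4}"
        using L square \<open>0 < p\<close> by (auto simp: eval_nat_numeral)
      ultimately have "\<exists>p. prime p \<and> n = p ^ 5
          \<and> large_divisors n = {p ^ 3, p ^ 4}"
        using square by blast
      then show ?thesis by (simp only: simp_thms)
    next
      fix q assume q: "prime q" "p < q" "n = p\<^sup>2 * q"
      moreover from this have "large_divisors n = {q, p * q}"
        using L square \<open>0 < p\<close> by (auto simp: power2_eq_square)
      ultimately have "\<exists>p q. prime p \<and> prime q \<and> p < q \<and> n = p ^ 2 * q
          \<and> (large_divisors n = {p ^ 2, p * q} \<or> large_divisors n = {q, p * q})"
        using square by blast
      then show ?thesis by (simp only: simp_thms)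
    qed
  next
    case (two p q)
    have "0 < p" "0 < q" using two by (simp_all add: prime_gt_0_nat)
    from two_small_divisors_primes[OF \<open>n > 0\<close> two] show ?thesis
    proof (elim disjE)
      assume "n = p\<^sup>2 * q"
      moreover from this have "large_divisors n = {p ^ 2, p * q}"
        using L two \<open>0 < p\<close> \<open>0 < q\<close> by (auto simp: power2_eq_square)
      ultimately have "\<exists>p q. prime p \<and> prime q \<and> p < q \<and> n = p ^ 2 * q
          \<and> (large_divisors n = {p ^ 2, p * q} \<or> large_divisors n = {q, p * q})"
        using two by blast
      then show ?thesis by (simp only: simp_thms)
    next
      assume "n = p * q\<^sup>2"
      moreover from this have "large_divisors n = {p * q, q ^ 2}"
        using L two \<open>0 < p\<close> \<open>0 < q\<close> by (auto simp: power2_eq_square)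
      ultimately have "\<exists>p q. prime p \<and> prime q \<and> p < q \<and> n = p * q ^ 2
          \<and> large_divisors n = {p * q, q ^ 2}"
        using two by blast
      then show ?thesis by (simp only: simp_thms)
    qed
  next
    case (three p q)
    have "0 < p" "0 < q" using three by (simp_all add: prime_gt_0_nat)
    have "real (q + 1) = real (2 * p)" using three by simp
    then have half: "real p = 1 / 2 * (real q + 1)" by simp
    from three_small_divisors[OF \<open>n > 0\<close> three(1-3,5)] show ?thesis
    proof (elim disjE exE conjE)
      \<comment> \<open>The theorem names the cubed prime \<open>p\<close>, so the roles of \<open>p\<close> and \<open>q\<close> are exchanged here.\<close>
      assume "n = p * q ^ 3"
      then have "n = q ^ 3 * p" by simp
      moreover from this have "large_divisors n = {q ^ 2, q ^ 2 * p, q ^ 3}"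
        using L three \<open>0 < p\<close> \<open>0 < q\<close> by (auto simp: power2_eq_square power3_eq_cube)
      ultimately have "\<exists>p q. prime p \<and> prime q \<and> p > q \<and> n = p ^ 3 * q
          \<and> real q = 1 / 2 * (real p + 1)
          \<and> large_divisors n = {p ^ 2, p ^ 2 * q, p ^ 3}"
        using three half by blast
      then show ?thesis by (simp only: simp_thms)
    next
      fix r assume r: "prime r" "p * q < r" "n = p * q * r"
      moreover from this have "large_divisors n = {r, r * p, r * q}"
        using L three \<open>0 < p\<close> \<open>0 < q\<close> by (auto simp: ac_simps)
      moreover have "q \<le> p * q" using \<open>0 < p\<close> by simp
      with r have "q < r" by linarith
      ultimately have "\<exists>p q r. prime p \<and> prime q \<and> prime r \<and> p < q
          \<and> q < r \<and> n = p * q * r \<and> p * q < r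
          \<and> real p = 1 / 2 * (real q + 1) \<and> large_divisors n = {r, r * p, r * q}"
        using three half by blast
      then show ?thesis by (simp only: simp_thms)
    qed
  qed
qed

end
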